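(* Let $m$ be an odd squarefree positive integer. Let $A\subset\mathbb{Z}_m^*$ be a subset with $|A|>\tfrac{5}{8}\phi(m)$. Then $A+A+A=\mathbb{Z}_m$.
   Context: $\mathbb{Z}_m=\mathbb{Z}/m\mathbb{Z}$, $\mathbb{Z}_m^*$ is the set of reduced residues (units) modulo $m$, and $\phi(m)=|\mathbb{Z}_m^*|$ is Euler's totient function. $A+A+A=\{a_1+a_2+a_3:a_1,a_2,a_3\in A\}$. *)

theory Defs
  imports "HOL-Number_Theory.Number_Theory" "HOL-Algebra.IntRing"
    "HOL-Computational_Algebra.Squarefree"
begin

end

theory Submission
  imports Defs
begin

text \<open>
  Give three densities \<open>x, y, z\<close> in \<open>[0, 1]\<close> the excess \<open>xy + yz + zx - 5/8 (x + y + z)\<close>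
  (scaled by 8 below). It is positive at \<open>x = y = z > 5/8\<close>, and among triples from \<open>{0, 1}\<close> only
  at \<open>(1, 1, 1)\<close>. Split off one prime \<open>p\<close> of \<open>m\<close> at a time: if the averages over the
  units modulo \<open>p\<close> of three functions have positive excess, then, whatever the target residue,
  so do the values of the functions at three units with that sum. Once the functions are the
  indicator of \<open>A\<close>, all three summands lie in \<open>A\<close>.

  For a single prime, sort the values of the functions decreasingly as \<open>a_i, b_j, c_k\<close> with indices
  below \<open>n = p - 1\<close>. By Cauchy--Davenport every index triple with \<open>i + j + k \<ge> n\<close> produces
  units with the required sum and at least these values, so it is enough that non-positive excess at all
  such triples passes to the averages. For \<open>n = 2h\<close> with \<open>h \<ge> 3\<close> this follows by cutting the
  sequences into halves and averaging over the Latin square \<open>i + j + k \<equiv> 0 (mod h)\<close>, which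
  misses the condition only at \<open>(0, 0, 0)\<close>. The claim fails for \<open>n = 4\<close> in general, but the primes
  5 and 3 come last, when only the values \<open>0, 1/2, 1\<close> and \<open>0, 1\<close> occur.
\<close>

subsection \<open>The excess of three densities\<close>

definition excess :: "real \<Rightarrow> real \<Rightarrow> real \<Rightarrow> real" where
  "excess x y z = 8 * (x * y + y * z + z * x) - 5 * (x + y + z)"

lemma excess_rotate: "excess x y z = excess y z x"
  by (simp add: excess_def algebra_simps)

lemma excess_diff: "excess x' y z - excess x y z = (x' - x) * (8 * (y + z) - 5)"
  by (simp add: excess_def algebra_simps)

lemma four_mult_le: "4 * (x * y) \<le> (x + y)\<^sup>2" for x y :: real
  using zero_le_power2[of "x - y"] by (simp add: power2_eq_square algebra_simps)

text \<open>For a fixed sum of two arguments the excess is largest when they are equal; the bound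
  depends on them only through \<open>x + y\<close>.\<close>

lemma excess_le_pair: "excess x y z \<le> 2 * (x + y)\<^sup>2 + z * (8 * (x + y) - 5) - 5 * (x + y)"
proof -
  have "excess x y z = 2 * (4 * (x * y)) + z * (8 * (x + y) - 5) - 5 * (x + y)"
    by (simp add: excess_def algebra_simps)
  then show ?thesis using four_mult_le[of x y] by linarith
qed

text \<open>With \<open>t = x + y\<close> at most 1, \<open>t^2 <= t\<close> reduces the pair bound
  to \<open>max 0 (8 * t - 5) - 3 * t\<close>, which is never positive.\<close>

lemma excess_pos_pair_gt_1:
  assumes "0 \<le> x" "0 \<le> y" "0 \<le> z" "z \<le> 1" "excess x y z > 0"
  shows "x + y > 1"
proof (rule ccontr)
  assume le: "\<not> x + y > 1"
  define t where "t = x + y"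
  have t: "0 \<le> t" "t \<le> 1" using assms le by (auto simp: t_def)
  have excess: "excess x y z \<le> 2 * t\<^sup>2 + z * (8 * t - 5) - 5 * t"
    unfolding t_def by (rule excess_le_pair)
  have "t\<^sup>2 \<le> t" using t by (simp add: power2_eq_square mult_left_le)
  moreover have "z * (8 * t - 5) \<le> max 0 (8 * t - 5)"
  proof (cases "8 * t \<ge> 5")
    case True then show ?thesis using assms mult_right_mono[of z 1 "8*t-5"] by simp
  next
    case False then show ?thesis using assms mult_nonneg_nonpos[of z "8*t-5"] by simp
  qed
  ultimately have "excess x y z \<le> 0" using excess t by (auto simp: max_def split: if_splits)
  then show False using assms by simp
qed

text \<open>The excess is not monotone on the whole cube, but where it is positive the other two
  arguments sum to more than 1, so the slope \<open>8 * (y + z) - 5\<close> is positive.\<close>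

lemma excess_pos_mono1:
  assumes "0 \<le> x" "x \<le> 1" "0 \<le> y" "0 \<le> z" "excess x y z > 0" "x \<le> x'"
  shows "excess x' y z > 0"
proof -
  have "y + z > 1"
    by (rule excess_pos_pair_gt_1[of y z x]) (use assms excess_rotate[of x y z] in auto)
  then have "(x' - x) * (8 * (y + z) - 5) \<ge> 0" using assms by simp
  then show ?thesis using excess_diff[of x' y z x] assms by linarith
qed

lemma excess_pos_mono:
  assumes "x \<in> {0..1}" "y \<in> {0..1}" "z \<in> {0..1}" "excess x y z > 0" "x \<le> x'" "y \<le> y'" "z \<le> z'"
    "x' \<le> 1" "y' \<le> 1" "z' \<le> 1"
  shows "excess x' y' z' > 0"
proof -
  have "excess x' y z > 0" by (rule excess_pos_mono1[of x]) (use assms in auto)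
  then have "excess y z x' > 0" by (simp only: excess_rotate[of y z x'] excess_rotate[of z x' y])
  then have "excess y' z x' > 0" by (rule excess_pos_mono1[of y, rotated 4]) (use assms in auto)
  then have "excess z x' y' > 0" by (simp only: excess_rotate[of z x' y'] excess_rotate[of x' y' z])
  then have "excess z' x' y' > 0" by (rule excess_pos_mono1[of z, rotated 4]) (use assms in auto)
  then show ?thesis by (simp only: excess_rotate[of z' x' y'])
qed

text \<open>Since \<open>3 * (x * y + y * z + z * x)\<close> is at most \<open>s^2\<close>, three
  times the excess is at most \<open>s * (8 * s - 15)\<close>.\<close>

lemma excess_pos_sum_gt:
  assumes "0 \<le> x" "0 \<le> y" "0 \<le> z" "excess x y z > 0"
  shows "x + y + z > 15/8"
proof (rule ccontr)
  define s where "s = x + y + z"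
  assume "\<not> x + y + z > 15/8"
  then have "s * (8 * s - 15) \<le> 0"
    using assms by (intro mult_nonneg_nonpos) (auto simp: s_def)
  moreover have "3 * excess x y z \<le> s * (8 * s - 15)"
    using zero_le_power2[of "x - y"] zero_le_power2[of "y - z"] zero_le_power2[of "z - x"]
    by (simp add: excess_def s_def power2_eq_square algebra_simps)
  ultimately show False using assms by linarith
qed

section \<open>Bounds for the block inequality\<close>

lemma excess_top_le:
  assumes "X \<le> 1" "Y \<le> 1" "X + Y \<ge> 1" "z \<ge> 0"
  shows "excess X Y z \<le> 11 * z - 2"
proof -
  define t where "t = X + Y"
  have t: "1 \<le> t" "t \<le> 2" using assms by (auto simp: t_def)
  have "excess X Y z \<le> 2 * t\<^sup>2 + z * (8 * t - 5) - 5 * t"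
    unfolding t_def by (rule excess_le_pair)
  \<comment> \<open>The target is the value at \<open>t = 2\<close>, that is at
    \<open>X = Y = 1\<close>; the two products below control the difference.\<close>
  also have "\<dots> \<le> 11 * z - 2"
  proof -
    have "z * (2 - t) \<ge> 0" "(2 - t) * (t - 1) \<ge> 0" using t assms by auto
    then show ?thesis using t by (simp add: power2_eq_square algebra_simps)
  qed
  finally show ?thesis .
qed

text \<open>If \<open>y + z <= 5/8\<close>, the excess does not increase with \<open>x\<close>, so
  \<open>x\<close> may be lowered to \<open>3/4 - (y + z)\<close>; the resulting quadratic in
  \<open>y + z\<close> is at most \<open>-9/4\<close>.\<close>

lemma excess_pair_sum_gt:
  assumes "0 \<le> x" "0 \<le> y" "0 \<le> z" "x + y + z \<ge> 3/4" "excess x y z > - 2"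
  shows "8 * (y + z) > 5"
proof (rule ccontr)
  assume le: "\<not> 8 * (y + z) > 5"
  define t where "t = y + z"
  have t: "8 * t \<le> 5" "x \<ge> 3/4 - t" using assms le by (auto simp: t_def)
  have "(4 * x - (3 - 4 * t)) * (5 - 8 * t) \<ge> 0" using t by simp
  moreover have "excess y z x \<le> 2 * t\<^sup>2 + x * (8 * t - 5) - 5 * t"
    unfolding t_def by (rule excess_le_pair)
  ultimately have "4 * excess x y z \<le> - 15 + 24 * t - 24 * t\<^sup>2"
    unfolding excess_rotate[of x] by (simp add: power2_eq_square algebra_simps)
  also have "\<dots> \<le> - 9"
    using zero_le_power2[of "2 * t - 1"] by (simp add: power2_eq_square algebra_simps)
  finally show False using assms by simp
qed

lemma excess_mono1:
  assumes "8 * (u + v) \<ge> 5" "x \<le> x'" shows "excess x u v \<le> excess x' u v"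
  using excess_diff[of x' u v x] mult_nonneg_nonneg[of "x'-x" "8*(u+v)-5"] assms by linarith

text \<open>The slopes \<open>g1\<close> and \<open>g2\<close> limit the increments:
  \<open>a * g1\<close> and \<open>b * g2\<close> are at most the defect \<open>D\<close>. As
  \<open>D <= 7/6\<close>, the product of the slopes is at least 9, so \<open>a * b\<close> is at
  most \<open>7/54 * D\<close>.\<close>

lemma defect_product:
  assumes g: "8 * (z + x) > 5" "8 * (y + z) > 5" and D: "excess x y z \<ge> - 7/6" "excess x y z \<le> 0"
    and "a \<ge> 0" "b \<ge> 0" "excess (x + a) y z \<le> 0" "excess x (y + b) z \<le> 0"
  shows "4 * (a * b) \<le> - excess x y z"
proof -
  define D where "D = - excess x y z"
  define g1 where "g1 = 8 * (y + z) - 5"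
  define g2 where "g2 = 8 * (z + x) - 5"
  have D0: "0 \<le> D" "D \<le> 7/6" using D by (auto simp: D_def)
  have "excess (x + a) y z = a * g1 - D" "excess x (y + b) z = b * g2 - D"
    by (simp_all add: g1_def g2_def D_def excess_def algebra_simps)
  moreover have "0 \<le> a * g1" "0 \<le> b * g2"
    using assms by (auto simp: g1_def g2_def)
  ultimately have 1: "0 \<le> a * g1" "a * g1 \<le> D" "0 \<le> b * g2" "b * g2 \<le> D"
    using assms by auto
  have "(a * g1) * (b * g2) \<le> D * D" using 1 D0 by (intro mult_mono) auto
  also have "\<dots> \<le> D * (7/6)" using D0 by (intro mult_left_mono) auto
  finally have 2: "(a * b) * (g1 * g2) \<le> 7/6 * D" by (simp add: algebra_simps)
  have "4 * (g1 * g2) = (16 * z - 5)\<^sup>2 + 75 - 32 * D"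
    by (simp add: g1_def g2_def D_def excess_def power2_eq_square algebra_simps)
  then have "g1 * g2 \<ge> 9" using D0 zero_le_power2[of "16 * z - 5"] by linarith
  then have "(a * b) * 9 \<le> (a * b) * (g1 * g2)" using assms by (intro mult_left_mono) auto
  then show ?thesis using 2 D0 by (simp add: D_def)
qed

text \<open>
  In the application \<open>X, Y, Z\<close> are the first terms of the three sequences, \<open>x, y, z\<close> the first terms
  of their second halves and \<open>x', y', z'\<close> the means of the second halves. The left-hand side of the
  last inequality bounds what the Latin squares lose at \<open>(0, 0, 0)\<close>; the factor 9 is the
  least admissible value of \<open>h\<^sup>2\<close>.
\<close>

lemma block_inequality:
  fixes x y z X Y Z x' y' z' :: real
  assumes rng: "0 \<le> x'" "x' \<le> x" "x \<le> X" "X \<le> 1" "0 \<le> y'" "y' \<le> y" "y \<le> Y" "Y \<le> 1"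
      "0 \<le> z'" "z' \<le> z" "z \<le> Z" "Z \<le> 1"
    and bad: "excess x y z \<le> 0" "excess X y z \<le> 0" "excess x Y z \<le> 0" "excess x y Z \<le> 0"
    and pairs: "X + Y \<ge> 1" "Y + Z \<ge> 1" "Z + X \<ge> 1"
    and sum: "x' + y' + z' \<ge> 3/4"
  shows "excess x' y' z' \<le> 0 \<and> excess X Y z + excess X y Z + excess x Y Z \<le> - 9 * excess x' y' z'"
proof -
  define F where "F = excess X Y z + excess X y Z + excess x Y Z"
  have F1: "F \<le> 11 * (x + y + z) - 6"
  proof -
    have "excess X Y z \<le> 11 * z - 2" by (rule excess_top_le) (use rng pairs in auto)
    moreover have "excess Z X y \<le> 11 * y - 2" by (rule excess_top_le) (use rng pairs in auto)
    moreover have "excess Y Z x \<le> 11 * x - 2" by (rule excess_top_le) (use rng pairs in auto)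
    moreover have "excess Z X y = excess X y Z" "excess Y Z x = excess x Y Z" by (simp_all add: excess_def algebra_simps)
    ultimately show ?thesis by (simp add: F_def algebra_simps)
  qed
  have "excess x' y' z' \<le> 0 \<and> F \<le> - 9 * excess x' y' z'"
  \<comment> \<open>Below -2 the crude bound suffices: \<open>x + y + z <= 24/11\<close> gives
    \<open>F <= 18\<close>. Otherwise all slopes at \<open>x', y', z'\<close> are positive, so the
    excess grows on the way to \<open>x, y, z\<close>, and \<open>F <= 9 * D\<close> is
    enough.\<close>
  proof (cases "excess x' y' z' \<le> - 2")
    case True
    have "(1 - x) * (1 - y) \<ge> 0" "(1 - y) * (1 - z) \<ge> 0" "(1 - z) * (1 - x) \<ge> 0"
      using rng by auto
    then have "11 * (x + y + z) \<le> 24" using bad(1) by (simp add: excess_def algebra_simps)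
    then show ?thesis using F1 True by argo
  next
    case False
    have g': "8 * (y' + z') > 5" "8 * (z' + x') > 5" "8 * (x' + y') > 5"
      using excess_pair_sum_gt[of x' y' z'] excess_pair_sum_gt[of y' z' x']
        excess_pair_sum_gt[of z' x' y'] excess_rotate[of x' y' z'] excess_rotate[of y' z' x']
        False rng sum by auto
    define D where "D = - excess x y z"
    have mono: "excess x' y' z' \<le> excess x y z"
    proof -
      have "excess x' y' z' \<le> excess x y' z'" using excess_mono1[of y' z' x' x] g' rng by simp
      also have "\<dots> = excess y' z' x" by (rule excess_rotate)
      also have "\<dots> \<le> excess y z' x" using excess_mono1[of z' x y' y] g' rng by simp
      also have "\<dots> = excess z' x y" by (rule excess_rotate)
      also have "\<dots> \<le> excess z x y" using excess_mono1[of x y z' z] g' rng by simp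
      also have "\<dots> = excess x y z" by (rule excess_rotate)
      finally show ?thesis .
    qed
    define a b c where "a = X - x" and "b = Y - y" and "c = Z - z"
    have abc: "a \<ge> 0" "b \<ge> 0" "c \<ge> 0" and XYZ: "X = x + a" "Y = y + b" "Z = z + c"
      using rng by (auto simp: a_def b_def c_def)
    \<comment> \<open>Expand around \<open>x, y, z\<close>, the excess being affine in each
      argument; by \<open>bad\<close> the terms with a single increment are non-positive.\<close>
    have "F = 2 * (excess X y z + excess x Y z + excess x y Z) + 3 * D + 8 * (a * b + b * c + c * a)"
      unfolding XYZ D_def F_def by (simp add: excess_def algebra_simps)
    then have F2: "F \<le> 3 * D + 8 * (a * b + b * c + c * a)"
      using bad by argo
    have "F \<le> 9 * D"
    proof -
      \<comment> \<open>The constant \<open>7/6\<close> makes \<open>F1\<close> just enough in the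
        first case: \<open>11 * 3/2 - 6 = 9 * 7/6\<close>. In the second, \<open>a + b + c\<close>
        is below \<open>3/2\<close>, so \<open>F <= 3 * D + 6\<close>. In the third,
        \<open>defect_product\<close> bounds each of the three products.\<close>
      consider "D \<ge> 7/6" "x + y + z \<le> 3/2" | "D \<ge> 7/6" "x + y + z > 3/2" | "D < 7/6" by argo
      then show ?thesis
      proof cases
        case 1 then show ?thesis using F1 by argo
      next
        case 2
        have "3 * (a * b + b * c + c * a) \<le> (a + b + c)\<^sup>2"
          using zero_le_power2[of "a - b"] zero_le_power2[of "b - c"] zero_le_power2[of "c - a"]
          by (simp add: power2_eq_square algebra_simps)
        also have "\<dots> \<le> (3/2)\<^sup>2"
          using abc XYZ 2 rng by (intro power_mono) auto
        also have "(3/2)\<^sup>2 = (9/4 :: real)" by (simp add: power2_eq_square)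
        finally show ?thesis using F2 2 by argo
      next
        case 3
        have g: "8 * (y + z) > 5" "8 * (z + x) > 5" "8 * (x + y) > 5" using g' rng by auto
        have D0: "excess x y z \<ge> - 7/6" using 3 by (simp add: D_def)
        have r: "excess y z x = excess x y z" "excess z x y = excess x y z" by (simp_all add: excess_def algebra_simps)
        have h: "excess (x + a) y z \<le> 0" "excess x (y + b) z \<le> 0" "excess (y + b) z x \<le> 0" "excess y (z + c) x \<le> 0"
            "excess (z + c) x y \<le> 0" "excess z (x + a) y \<le> 0"
          using bad(2-) excess_rotate[of x "y + b" z] excess_rotate[of x y "z + c"] excess_rotate[of "x + a" y z]
            excess_rotate[of "z + c" x y] excess_rotate[of z "x + a" y] unfolding XYZ by argo+
        have "4 * (a * b) \<le> - excess x y z"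
          by (rule defect_product) (use g D0 bad(1) abc h in auto)
        moreover have "4 * (b * c) \<le> - excess y z x"
          by (rule defect_product) (use g D0 bad(1) abc h r in auto)
        moreover have "4 * (c * a) \<le> - excess z x y"
          by (rule defect_product) (use g D0 bad(1) abc h r in auto)
        ultimately have "8 * (a * b + b * c + c * a) \<le> 6 * D"
          unfolding r D_def by argo
        then show ?thesis using F2 by argo
      qed
    qed
    then show ?thesis using mono bad(1) by (simp add: D_def)
  qed
  then show ?thesis by (simp add: F_def)
qed

subsection \<open>Averages of sorted sequences\<close>

definition mean :: "'a set \<Rightarrow> ('a \<Rightarrow> real) \<Rightarrow> real" where
  "mean S f = sum f S / card S"

lemma mean_bounds:
  assumes "finite S" "S \<noteq> {}" "\<And>i. i \<in> S \<Longrightarrow> l \<le> f i" "\<And>i. i \<in> S \<Longrightarrow> f i \<le> u"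
  shows "l \<le> mean S f" "mean S f \<le> u"
proof -
  have c: "real (card S) > 0" using assms by (simp add: card_gt_0_iff)
  have "of_nat (card S) * l \<le> sum f S" "sum f S \<le> of_nat (card S) * u"
    using assms by (intro sum_bounded_below sum_bounded_above; simp)+
  then show "l \<le> mean S f" "mean S f \<le> u"
    using c by (simp_all add: mean_def field_simps)
qed

text \<open>The residue completing \<open>i, j < h\<close> to \<open>i + j + k \<equiv> 0 (mod h)\<close>.\<close>

definition third :: "nat \<Rightarrow> nat \<Rightarrow> nat \<Rightarrow> nat" where
  "third h i j = (if i = 0 \<and> j = 0 then 0 else if i + j \<le> h then h - i - j else 2 * h - i - j)"

lemma third_less: "i < h \<Longrightarrow> j < h \<Longrightarrow> third h i j < h"
  and third_ge: "i < h \<Longrightarrow> j < h \<Longrightarrow> i \<noteq> 0 \<or> j \<noteq> 0 \<Longrightarrow> h \<le> i + j + third h i j"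
  and third_third: "i < h \<Longrightarrow> j < h \<Longrightarrow> third h i (third h i j) = j"
  and third_commute: "third h i j = third h j i"
  by (auto simp: third_def)

lemma sum_third: "i < h \<Longrightarrow> (\<Sum>j<h. f (third h i j)) = (\<Sum>j<h. f j)"
  by (rule sum.reindex_bij_witness[of _ "third h i" "third h i"]) (auto simp: third_less third_third)

text \<open>Each product involves two of the three indices, and any two of them run over all pairs
  exactly once, so every sum of products factors.\<close>

lemma sum_latin_square:
  assumes "h > 0"
  shows "(\<Sum>i<h. \<Sum>j<h. excess (a i) (b j) (c (third h i j)))
    = (real h)\<^sup>2 * excess (mean {..<h} a) (mean {..<h} b) (mean {..<h} c)"
proof -
  define A B C where "A = sum a {..<h}" and "B = sum b {..<h}" and "C = sum c {..<h}"
  have ab: "(\<Sum>i<h. \<Sum>j<h. a i * b j) = A * B"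
    by (simp add: A_def B_def sum_product)
  have ac: "(\<Sum>i<h. \<Sum>j<h. c (third h i j) * a i) = C * A"
    by (simp add: A_def C_def sum_third flip: sum_distrib_right sum_distrib_left)
  have "(\<Sum>i<h. \<Sum>j<h. b j * c (third h i j)) = (\<Sum>j<h. \<Sum>i<h. b j * c (third h j i))"
    by (subst sum.swap) (simp add: third_commute)
  then have bc: "(\<Sum>i<h. \<Sum>j<h. b j * c (third h i j)) = B * C"
    by (simp add: B_def C_def sum_third flip: sum_distrib_right sum_distrib_left)
  have "(\<Sum>i<h. \<Sum>j<h. a i + b j + c (third h i j)) = h * (A + B + C)"
    by (simp add: sum.distrib sum_third A_def B_def C_def algebra_simps flip: sum_distrib_left)
  then have "(\<Sum>i<h. \<Sum>j<h. excess (a i) (b j) (c (third h i j)))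
    = 8 * (A * B + B * C + C * A) - 5 * (h * (A + B + C))"
    using ab ac bc by (simp add: excess_def sum.distrib sum_subtractf flip: sum_distrib_left)
  also have "\<dots> = (real h)\<^sup>2 * excess (A / h) (B / h) (C / h)"
    using assms by (simp add: excess_def power2_eq_square field_simps)
  finally show ?thesis by (simp add: mean_def A_def B_def C_def)
qed

lemma latin_square_le:
  assumes "h > 0" and "\<And>i j k. i < h \<Longrightarrow> j < h \<Longrightarrow> k < h \<Longrightarrow> h \<le> i + j + k \<Longrightarrow> excess (a i) (b j) (c k) \<le> 0"
  shows "(real h)\<^sup>2 * excess (mean {..<h} a) (mean {..<h} b) (mean {..<h} c) \<le> excess (a 0) (b 0) (c 0)"
proof -
  have "(\<Sum>i<h. \<Sum>j<h. excess (a i) (b j) (c (third h i j)))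
      \<le> (\<Sum>i<h. \<Sum>j<h. if j = 0 then if i = 0 then excess (a 0) (b 0) (c 0) else 0 else 0)"
    using assms third_less third_ge by (intro sum_mono) (auto simp: third_def)
  also have "\<dots> = excess (a 0) (b 0) (c 0)"
    using assms(1) by (simp add: sum.delta)
  finally show ?thesis by (simp add: sum_latin_square[OF assms(1)])
qed

definition nonincreasing :: "nat \<Rightarrow> (nat \<Rightarrow> real) \<Rightarrow> bool" where
  "nonincreasing n a \<longleftrightarrow> (\<forall>i j. i \<le> j \<longrightarrow> j < n \<longrightarrow> a j \<le> a i)"

definition mean_closed :: "real set \<Rightarrow> nat \<Rightarrow> bool" where
  "mean_closed V n \<longleftrightarrow> (\<forall>a b c. a ` {..<n} \<subseteq> V \<and> b ` {..<n} \<subseteq> V \<and> c ` {..<n} \<subseteq> V \<and>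
     nonincreasing n a \<and> nonincreasing n b \<and> nonincreasing n c \<and>
     (\<forall>i<n. \<forall>j<n. \<forall>k<n. n \<le> i + j + k \<longrightarrow> excess (a i) (b j) (c k) \<le> 0)
     \<longrightarrow> excess (mean {..<n} a) (mean {..<n} b) (mean {..<n} c) \<le> 0)"

lemma mean_halves:
  fixes h :: nat
  assumes "h > 0"
  shows "mean {..<2 * h} a = (mean {..<h} a + mean {..<h} (\<lambda>i. a (h + i))) / 2"
proof -
  have "sum a {..<2 * h} = sum a {..<h} + sum a {h..<2 * h}"
    using sum.atLeastLessThan_concat[of 0 h "2 * h" a] by (simp add: atLeast0LessThan)
  also have "sum a {h..<2 * h} = (\<Sum>i<h. a (h + i))"
    using sum.shift_bounds_nat_ivl[of a 0 h h] by (simp add: atLeast0LessThan mult_2 add.commute)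
  finally show ?thesis using assms by (simp add: mean_def field_simps)
qed

text \<open>Only terms with an odd number of second halves (primed) occur. A single second half
  shifts the index sum by \<open>h\<close>, exactly the gap between the Latin square condition
  \<open>h <= i + j + k\<close> and the condition at length \<open>2 * h\<close>.\<close>

lemma excess_mean_halves:
  "4 * excess ((x + x') / 2) ((y + y') / 2) ((z + z') / 2)
    = excess x y z' + excess x y' z + excess x' y z + excess x' y' z'"
  by (simp add: excess_def field_simps)

lemma mean_closed_unit_interval:
  assumes "h \<ge> 3"
  shows "mean_closed {0..1} (2 * h)"
  unfolding mean_closed_def
proof (intro allI impI, elim conjE)
  fix a b c :: "nat \<Rightarrow> real"
  assume V: "a ` {..<2*h} \<subseteq> {0..1}" "b ` {..<2*h} \<subseteq> {0..1}" "c ` {..<2*h} \<subseteq> {0..1}"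
    and dec: "nonincreasing (2*h) a" "nonincreasing (2*h) b" "nonincreasing (2*h) c"
    and "\<forall>i<2*h. \<forall>j<2*h. \<forall>k<2*h. 2*h \<le> i + j + k \<longrightarrow> excess (a i) (b j) (c k) \<le> 0"
  then have bad: "excess (a i) (b j) (c k) \<le> 0"
    if "i < 2*h" "j < 2*h" "k < 2*h" "2*h \<le> i + j + k" for i j k using that by blast
  have h: "h > 0" using assms by simp
  let ?H = "\<lambda>f. mean {..<h} f" and ?T = "\<lambda>f. mean {..<h} (\<lambda>i. f (h + i))"
  have props: "0 \<le> f i \<and> f i \<le> 1" "f (h + k) \<le> f h" "f h \<le> f 0" "?H f \<le> f 0" "0 \<le> ?H f" "0 \<le> ?T f" "?T f \<le> f h"
    if "f ` {..<2*h} \<subseteq> {0..1}" "nonincreasing (2*h) f" "i < 2*h" "k < h" for f i k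
  proof -
    have v: "0 \<le> f i \<and> f i \<le> 1" if "i < 2*h" for i using \<open>f ` _ \<subseteq> _\<close> that by (auto simp: image_subset_iff)
    have m: "f j \<le> f i" if "i \<le> j" "j < 2*h" for i j
      using \<open>nonincreasing _ f\<close> that by (auto simp: nonincreasing_def)
    show "0 \<le> f i \<and> f i \<le> 1" "f (h + k) \<le> f h" "f h \<le> f 0" using v m that h by auto
    show "?H f \<le> f 0" "?T f \<le> f h" by (rule mean_bounds(2)[where l = 0]; use v m h in auto)+
    show "0 \<le> ?H f" "0 \<le> ?T f" by (rule mean_bounds(1)[where u = 1]; use v m h in auto)+
  qed
  note pa = props[OF V(1) dec(1)] and pb = props[OF V(2) dec(2)] and pc = props[OF V(3) dec(3)]
  have hs: "0 < 2 * h" "h < 2 * h" using h by auto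
  define Q where "Q = excess (mean {..<2*h} a) (mean {..<2*h} b) (mean {..<2*h} c)"
  show "Q \<le> 0"
  proof (rule ccontr)
    assume "\<not> Q \<le> 0"
    then have Q: "excess ((?H a + ?T a) / 2) ((?H b + ?T b) / 2) ((?H c + ?T c) / 2) > 0"
      by (simp add: Q_def mean_halves[OF h])
    have avg: "0 \<le> (u + t) / 2 \<and> (u + t) / 2 \<le> m" if "0 \<le> u" "u \<le> m" "0 \<le> t" "t \<le> s" "s \<le> m" for u t s m :: real
      using that by simp
    have le: "0 \<le> (?H a + ?T a) / 2 \<and> (?H a + ?T a) / 2 \<le> a 0" "a 0 \<le> 1"
        "0 \<le> (?H b + ?T b) / 2 \<and> (?H b + ?T b) / 2 \<le> b 0" "b 0 \<le> 1"
        "0 \<le> (?H c + ?T c) / 2 \<and> (?H c + ?T c) / 2 \<le> c 0" "c 0 \<le> 1"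
      using pa[OF hs(1) h] pb[OF hs(1) h] pc[OF hs(1) h] avg by blast+
    \<comment> \<open>The averages total more than \<open>15/8\<close> and the first-half means at
      most 3, which leaves \<open>15/4 - 3\<close> for the second halves.\<close>
    have sum: "?T a + ?T b + ?T c \<ge> 3/4"
      using excess_pos_sum_gt[OF _ _ _ Q] pa(4)[OF hs(1) h] pb(4)[OF hs(1) h] pc(4)[OF hs(1) h] le by argo
    have pairs: "a 0 + b 0 \<ge> 1" "b 0 + c 0 \<ge> 1" "c 0 + a 0 \<ge> 1"
    proof -
      note Q' = Q[unfolded excess_rotate[of "(?H a + ?T a) / 2"]]
      note Q'' = Q'[unfolded excess_rotate[of "(?H b + ?T b) / 2"]]
      have "(?H a + ?T a) / 2 + (?H b + ?T b) / 2 > 1" "(?H b + ?T b) / 2 + (?H c + ?T c) / 2 > 1"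
        "(?H c + ?T c) / 2 + (?H a + ?T a) / 2 > 1"
        by (rule excess_pos_pair_gt_1[OF _ _ _ _ Q] excess_pos_pair_gt_1[OF _ _ _ _ Q']
            excess_pos_pair_gt_1[OF _ _ _ _ Q'']; use le in argo)+
      then show "a 0 + b 0 \<ge> 1" "b 0 + c 0 \<ge> 1" "c 0 + a 0 \<ge> 1" using le by argo+
    qed
    have block: "excess (?T a) (?T b) (?T c) \<le> 0 \<and>
        excess (a 0) (b 0) (c h) + excess (a 0) (b h) (c 0) + excess (a h) (b 0) (c 0) \<le> - 9 * excess (?T a) (?T b) (?T c)"
    proof (rule block_inequality)
      show "excess (a h) (b h) (c h) \<le> 0" "excess (a 0) (b h) (c h) \<le> 0" "excess (a h) (b 0) (c h) \<le> 0"
        "excess (a h) (b h) (c 0) \<le> 0" using h by (auto intro!: bad)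
    qed (use sum pairs le pa[OF hs(2) h] pb[OF hs(2) h] pc[OF hs(2) h] in auto)
    have 1: "(real h)\<^sup>2 * excess (?H a) (?H b) (?T c) \<le> excess (a 0) (b 0) (c (h + 0))"
      using h bad by (intro latin_square_le) auto
    have 2: "(real h)\<^sup>2 * excess (?H a) (?T b) (?H c) \<le> excess (a 0) (b (h + 0)) (c 0)"
      using h bad by (intro latin_square_le) auto
    have 3: "(real h)\<^sup>2 * excess (?T a) (?H b) (?H c) \<le> excess (a (h + 0)) (b 0) (c 0)"
      using h bad by (intro latin_square_le) auto
    \<comment> \<open>The second-half means have non-positive excess, so the factor
      \<open>h^2 >= 9\<close> makes that term negative enough to absorb the losses of the three
      squares.\<close>
    have "(3::real)\<^sup>2 \<le> (real h)\<^sup>2" using assms by (intro power_mono) auto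
    then have 4: "(real h)\<^sup>2 * excess (?T a) (?T b) (?T c) \<le> 9 * excess (?T a) (?T b) (?T c)"
      using block by (intro mult_right_mono_neg) auto
    have "(real h)\<^sup>2 * (4 * excess ((?H a + ?T a) / 2) ((?H b + ?T b) / 2) ((?H c + ?T c) / 2)) \<le> 0"
      unfolding excess_mean_halves distrib_left using 1 2 3 4 block by simp
    then show False using Q h by (simp add: mult_le_0_iff)
  qed
qed

section \<open>Short sequences: the primes 3 and 5\<close>

lemma mean_closed_2: "mean_closed {0, 1} 2"
  unfolding mean_closed_def
proof (intro allI impI, elim conjE)
  fix a b c :: "nat \<Rightarrow> real"
  assume *: "a ` {..<2} \<subseteq> {0,1}" "b ` {..<2} \<subseteq> {0,1}" "c ` {..<2} \<subseteq> {0,1}"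
     "nonincreasing 2 a" "nonincreasing 2 b" "nonincreasing 2 c"
     "\<forall>i<2. \<forall>j<2. \<forall>k<2. 2 \<le> i + j + k \<longrightarrow> excess (a i) (b j) (c k) \<le> 0"
  have 2: "{..<2::nat} = {0, 1}" by auto
  have "a 1 \<le> a 0" "b 1 \<le> b 0" "c 1 \<le> c 0" using * by (auto simp: nonincreasing_def)
  moreover have "excess (a 1) (b 1) (c 0) \<le> 0" "excess (a 1) (b 0) (c 1) \<le> 0" "excess (a 0) (b 1) (c 1) \<le> 0" 
    using * by auto
  \<comment> \<open>The means lie in \<open>{0, 1/2, 1}\<close>, and their excess is positive only
    if two are 1 and the third is nonzero (it vanishes at \<open>1, 1/2, 1/2\<close>). The third
    sequence then starts with 1, which yields a forbidden triple of ones.\<close>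
  ultimately show "excess (mean {..<2} a) (mean {..<2} b) (mean {..<2} c) \<le> 0"
    using *(1-3) by (auto simp: 2 mean_def excess_def)
qed

text \<open>Here \<open>r\<close> counts the ones and \<open>p\<close> the nonzero entries; sorting
  makes both sets initial segments, and each entry is half the sum of its two indicators.\<close>

lemma three_level_counts:
  assumes a: "a ` {..<4} \<subseteq> {0, 1/2, 1}" and "nonincreasing 4 a"
  obtains r p :: nat where "r \<le> p" "p \<le> 4" "mean {..<4} a = (real r + real p) / 8"
    "\<And>i. i < r \<Longrightarrow> a i = 1" "\<And>i. i < p \<Longrightarrow> a i \<ge> 1/2"
proof
  define r where "r i = (if a i = 1 then 1 else 0 :: nat)" for i
  define p where "p i = (if a i \<ge> 1/2 then 1 else 0 :: nat)" for i
  let ?r = "r 0 + r 1 + r 2 + r 3" and ?p = "p 0 + p 1 + p 2 + p 3"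
  have 4: "{..<4::nat} = {0, 1, 2, 3}" by auto
  have v: "a 0 \<in> {0, 1/2, 1}" "a 1 \<in> {0, 1/2, 1}" "a 2 \<in> {0, 1/2, 1}" "a 3 \<in> {0, 1/2, 1}"
    using a by (auto simp: 4)
  have m: "a 1 \<le> a 0" "a 2 \<le> a 1" "a 3 \<le> a 2"
    using assms(2) by (auto simp: nonincreasing_def)
  show "?r \<le> ?p" "?p \<le> 4" by (auto simp: r_def p_def)
  have "a i = (real (r i) + real (p i)) / 2" if "a i \<in> {0, 1/2, 1}" for i
    using that by (auto simp: r_def p_def)
  from this[OF v(1)] this[OF v(2)] this[OF v(3)] this[OF v(4)]
  show "mean {..<4} a = (real ?r + real ?p) / 8"
    by (simp add: mean_def 4)
  have cases4: "i = 0 \<or> i = 1 \<or> i = 2 \<or> i = 3" if "i < ?r \<or> i < ?p" for i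
    using that by (auto simp: r_def p_def split: if_splits)
  show "a i = 1" if "i < ?r" for i
    using cases4[of i] that v m by (auto simp: r_def split: if_splits)
  show "a i \<ge> 1/2" if "i < ?p" for i
    using cases4[of i] that v m by (auto simp: p_def split: if_splits)
qed

lemma excess_two_ones: "excess 1 1 z > 0 \<longleftrightarrow> z > 2/11" "excess 1 z 1 > 0 \<longleftrightarrow> z > 2/11" "excess z 1 1 > 0 \<longleftrightarrow> z > 2/11"
  by (auto simp: excess_def)

lemma mean_closed_4: "mean_closed {0, 1/2, 1} 4"
  unfolding mean_closed_def
proof (intro allI impI, elim conjE)
  fix a b c :: "nat \<Rightarrow> real"
  assume V: "a ` {..<4} \<subseteq> {0, 1/2, 1}" "b ` {..<4} \<subseteq> {0, 1/2, 1}" "c ` {..<4} \<subseteq> {0, 1/2, 1}"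
    and dec: "nonincreasing 4 a" "nonincreasing 4 b" "nonincreasing 4 c"
    and bad: "\<forall>i<4. \<forall>j<4. \<forall>k<4. 4 \<le> i + j + k \<longrightarrow> excess (a i) (b j) (c k) \<le> 0"
  obtain r1 p1 where 1: "r1 \<le> p1" "p1 \<le> 4" "mean {..<4} a = (real r1 + real p1) / 8"
    "\<And>i. i < r1 \<Longrightarrow> a i = 1" "\<And>i. i < p1 \<Longrightarrow> a i \<ge> 1/2"
    using three_level_counts[OF V(1) dec(1)] by metis
  obtain r2 p2 where 2: "r2 \<le> p2" "p2 \<le> 4" "mean {..<4} b = (real r2 + real p2) / 8"
    "\<And>i. i < r2 \<Longrightarrow> b i = 1" "\<And>i. i < p2 \<Longrightarrow> b i \<ge> 1/2"
    using three_level_counts[OF V(2) dec(2)] by metis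
  obtain r3 p3 where 3: "r3 \<le> p3" "p3 \<le> 4" "mean {..<4} c = (real r3 + real p3) / 8"
    "\<And>i. i < r3 \<Longrightarrow> c i = 1" "\<And>i. i < p3 \<Longrightarrow> c i \<ge> 1/2"
    using three_level_counts[OF V(3) dec(3)] by metis
  have bad': "i + j + k < 4" if "excess (a i) (b j) (c k) > 0" "i < 4" "j < 4" "k < 4" for i j k
    using bad that by (meson leI not_le)
  \<comment> \<open>The entries at \<open>r1 - 1\<close>, \<open>r2 - 1\<close>,
    \<open>p3 - 1\<close> are 1, 1 and at least \<open>1/2\<close>, above the threshold
    \<open>2/11\<close>. Hence these indices total at most 3.\<close>
  have A: "r1 + r2 + p3 \<le> 6" if "r1 > 0" "r2 > 0" "p3 > 0"
  proof -
    have "(r1 - 1) + (r2 - 1) + (p3 - 1) < 4"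
      by (rule bad') (use 1(4)[of "r1 - 1"] 2(4)[of "r2 - 1"] 3(5)[of "p3 - 1"] that 1(1,2) 2(1,2) 3(1,2) in \<open>auto simp: excess_two_ones\<close>)
    then show ?thesis using that by linarith
  qed
  have B: "r1 + p2 + r3 \<le> 6" if "r1 > 0" "p2 > 0" "r3 > 0"
  proof -
    have "(r1 - 1) + (p2 - 1) + (r3 - 1) < 4"
      by (rule bad') (use 1(4)[of "r1 - 1"] 2(5)[of "p2 - 1"] 3(4)[of "r3 - 1"] that 1(1,2) 2(1,2) 3(1,2) in \<open>auto simp: excess_two_ones\<close>)
    then show ?thesis using that by linarith
  qed
  have C: "p1 + r2 + r3 \<le> 6" if "p1 > 0" "r2 > 0" "r3 > 0"
  proof -
    have "(p1 - 1) + (r2 - 1) + (r3 - 1) < 4"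
      by (rule bad') (use 1(5)[of "p1 - 1"] 2(4)[of "r2 - 1"] 3(4)[of "r3 - 1"] that 1(1,2) 2(1,2) 3(1,2) in \<open>auto simp: excess_two_ones\<close>)
    then show ?thesis using that by linarith
  qed
  show "excess (mean {..<4} a) (mean {..<4} b) (mean {..<4} c) \<le> 0"
  proof (rule ccontr)
    let ?x = "(real r1 + real p1) / 8" and ?y = "(real r2 + real p2) / 8" and ?z = "(real r3 + real p3) / 8"
    assume "\<not> excess (mean {..<4} a) (mean {..<4} b) (mean {..<4} c) \<le> 0"
    then have pos: "excess ?x ?y ?z > 0" "excess ?y ?z ?x > 0" "excess ?z ?x ?y > 0"
      using excess_rotate[of ?x ?y ?z] excess_rotate[of ?y ?z ?x] by (simp_all add: 1(3) 2(3) 3(3))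
    have rng: "0 \<le> ?x" "?x \<le> 1" "0 \<le> ?y" "?y \<le> 1" "0 \<le> ?z" "?z \<le> 1"
      using 1(1,2) 2(1,2) 3(1,2) by simp_all
    have "real 8 < real (r1 + p1 + r2 + p2)" "real 8 < real (r2 + p2 + r3 + p3)"
        "real 8 < real (r3 + p3 + r1 + p1)"
      using excess_pos_pair_gt_1[OF rng(1,3,5,6) pos(1)] excess_pos_pair_gt_1[OF rng(3,5,1,2) pos(2)]
        excess_pos_pair_gt_1[OF rng(5,1,3,4) pos(3)] by (simp_all add: field_simps)
    then have "r1 + p1 + r2 + p2 > 8" "r2 + p2 + r3 + p3 > 8" "r3 + p3 + r1 + p1 > 8"
      unfolding of_nat_less_iff .
    moreover have "real 15 < real (r1 + p1 + r2 + p2 + r3 + p3)"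
      using excess_pos_sum_gt[OF rng(1,3,5) pos(1)] by (simp add: field_simps)
    then have "r1 + p1 + r2 + p2 + r3 + p3 > 15"
      unfolding of_nat_less_iff .
    txt \<open>
      If all \<open>r\<close> are positive, adding \<open>A\<close>, \<open>B\<close> and \<open>C\<close> leaves at most 2 for the sum
      of the \<open>r\<close>. If, say, \<open>r1 = 0\<close>, then \<open>p1 \<le> 4\<close> forces \<open>r2, r3 > 0\<close>, and \<open>C\<close> contradicts
      the total being at least 16.
    \<close>
    ultimately show False
      using A B C 1(1,2) 2(1,2) 3(1,2) by linarith
  qed
qed

subsection \<open>The Cauchy--Davenport theorem\<close>

definition sumset_mod :: "int \<Rightarrow> int set \<Rightarrow> int set \<Rightarrow> int set" where
  "sumset_mod p A B = (\<lambda>(a, b). (a + b) mod p) ` (A \<times> B)"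

lemma inj_on_shift_mod: "A \<subseteq> {0..<p} \<Longrightarrow> inj_on (\<lambda>a. (a + e) mod p) A" for p :: int
proof (rule inj_onI)
  fix a b assume "A \<subseteq> {0..<p}" "a \<in> A" "b \<in> A" "(a + e) mod p = (b + e) mod p"
  then have "[a + e = b + e] (mod p)" "0 \<le> a" "a < p" "0 \<le> b" "b < p" by (auto simp: cong_def)
  then show "a = b" by (metis cong_add_rcancel cong_less_imp_eq_int)
qed

text \<open>\<open>d\<close> generates the residues modulo \<open>p\<close>, so the orbit of a
  single point of \<open>A\<close> is everything.\<close>

lemma invariant_under_shift_mod_prime:
  fixes p :: int
  assumes "prime p" "A \<subseteq> {0..<p}" "A \<noteq> {}" "\<not> p dvd d" "\<And>a. a \<in> A \<Longrightarrow> (a + d) mod p \<in> A"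
  shows "A = {0..<p}"
proof
  obtain a where a: "a \<in> A" using assms by blast
  have orbit: "(a + int k * d) mod p \<in> A" for k
  proof (induction k)
    case 0 then show ?case using a assms(2) by (auto simp: subset_iff)
  next
    case (Suc k)
    have "a + int (Suc k) * d = (a + int k * d) + d" by (simp add: algebra_simps)
    then have "(a + int (Suc k) * d) mod p = ((a + int k * d) mod p + d) mod p"
      by (simp only: mod_add_left_eq)
    then show ?case using assms(5)[OF Suc] by simp
  qed
  have "coprime d p" using prime_imp_coprime[OF assms(1,4)] by (simp add: coprime_commute)
  then obtain x where x: "[d * x = 1] (mod p)" using cong_solve_coprime_int by blast
  have p: "p > 0" using assms(1) by (simp add: prime_gt_0_int)
  show "{0..<p} \<subseteq> A"
  proof
    fix r assume r: "r \<in> {0..<p}"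
    \<comment> \<open>As \<open>x\<close> inverts \<open>d\<close>, this many steps of size
      \<open>d\<close> lead from \<open>a\<close> to \<open>r\<close>.\<close>
    define k where "k = nat ((x * (r - a)) mod p)"
    have "int k = (x * (r - a)) mod p" using p by (simp add: k_def)
    then have "[a + int k * d = a + (x * (r - a)) * d] (mod p)"
      by (intro cong_add cong_mult) (auto simp: cong_def)
    also have "a + (x * (r - a)) * d = a + (d * x) * (r - a)" by (simp add: algebra_simps)
    also have "[a + (d * x) * (r - a) = a + 1 * (r - a)] (mod p)"
      by (intro cong_add cong_mult x cong_refl)
    finally have "(a + int k * d) mod p = r" using r by (simp add: cong_def)
    then show "r \<in> A" using orbit by metis
  qed
qed (use assms in auto)

text \<open>Induction on the size of \<open>B\<close>: unless \<open>A\<close> is everything or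
  \<open>B\<close> is a singleton, residues can be traded from \<open>B\<close> to \<open>A\<close>
  with the total size kept and no new sums created.\<close>

theorem Cauchy_Davenport:
  fixes p :: int
  assumes "prime p" "A \<subseteq> {0..<p}" "B \<subseteq> {0..<p}" "A \<noteq> {}" "B \<noteq> {}"
  shows "min (nat p) (card A + card B - 1) \<le> card (sumset_mod p A B)"
  using assms
proof (induction "card B" arbitrary: A B rule: less_induct)
  case less
  note fin = finite_subset[OF less.prems(2)] finite_subset[OF less.prems(3)]
  have fS: "finite (sumset_mod p A B)" using fin by (simp add: sumset_mod_def)
  have ge: "card A \<le> card (sumset_mod p A B)" if "b \<in> B" for b
  proof -
    have "card A = card ((\<lambda>a. (a + b) mod p) ` A)"
      using inj_on_shift_mod[OF less.prems(2)] by (simp add: card_image)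
    also have "\<dots> \<le> card (sumset_mod p A B)"
      using that fS by (intro card_mono) (auto simp: sumset_mod_def)
    finally show ?thesis .
  qed
  obtain b1 where b1: "b1 \<in> B" using less.prems by blast
  show ?case
  proof (cases "A = {0..<p} \<or> B = {b1}")
    case True
    then show ?thesis using ge[OF b1] by auto
  next
    case False
    then obtain b2 where b2: "b2 \<in> B" "b2 \<noteq> b1" using b1 by blast
    have "\<not> p dvd b2 - b1"
    proof
      assume "p dvd b2 - b1"
      then have "[b2 = b1] (mod p)" by (simp add: cong_iff_dvd_diff)
      moreover have "0 \<le> b1" "b1 < p" "0 \<le> b2" "b2 < p" using b1 b2 less.prems(3) by auto
      ultimately show False using b2 cong_less_imp_eq_int by blast
    qed
    then obtain a where a: "a \<in> A" "(a + (b2 - b1)) mod p \<notin> A"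
      using invariant_under_shift_mod_prime[OF less.prems(1,2,4)] False by blast
    \<comment> \<open>Shifted by \<open>e\<close>, \<open>b1\<close> lands on \<open>a\<close> in
      \<open>A\<close> and \<open>b2\<close> lands outside \<open>A\<close>. So \<open>b1\<close>
      keeps the new \<open>B\<close> nonempty, and the loss of \<open>b2\<close> makes it
      smaller.\<close>
    define e where "e = a - b1"
    txt \<open>Davenport's transform: move the elements of \<open>B\<close> whose shift by \<open>e\<close> leaves \<open>A\<close>.\<close>
    define M where "M = {b \<in> B. (b + e) mod p \<notin> A}"
    define A' where "A' = A \<union> (\<lambda>b. (b + e) mod p) ` M"
    define B' where "B' = B - M"
    have b1': "b1 \<in> B'" using a b1 less.prems(2) by (auto simp: B'_def M_def e_def subset_iff)
    have b2': "b2 \<in> M" using a b2 by (auto simp: M_def e_def algebra_simps)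
    have p: "p > 0" using less.prems(1) by (simp add: prime_gt_0_int)
    have MB: "M \<subseteq> B" by (auto simp: M_def)
    have finM: "finite M" using MB fin finite_subset by blast
    have injM: "inj_on (\<lambda>b. (b + e) mod p) M"
      using MB less.prems(3) by (intro inj_on_shift_mod) blast
    have "card A' = card A + card ((\<lambda>b. (b + e) mod p) ` M)"
      using fin finM unfolding A'_def by (intro card_Un_disjoint) (auto simp: M_def)
    then have "card A' = card A + card M" by (simp add: card_image[OF injM])
    moreover have "card B' = card B - card M" "card M \<le> card B"
      using MB fin finM by (auto simp: B'_def card_Diff_subset card_mono)
    ultimately have cards: "card A' + card B' = card A + card B" by simp
    have "card M > 0" using b2' finM card_gt_0_iff by blast
    then have "card B' < card B"
      using \<open>card B' = card B - card M\<close> \<open>card M \<le> card B\<close> by simp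
    moreover have "A' \<subseteq> {0..<p}" "B' \<subseteq> {0..<p}" "A' \<noteq> {}" "B' \<noteq> {}"
      using less.prems p b1' by (auto simp: A'_def B'_def)
    ultimately have "min (nat p) (card A' + card B' - 1) \<le> card (sumset_mod p A' B')"
      using less.hyps less.prems(1) by blast
    also have "\<dots> \<le> card (sumset_mod p A B)"
    proof (rule card_mono[OF fS], rule subsetI)
      fix s assume "s \<in> sumset_mod p A' B'"
      then obtain x y where s: "s = (x + y) mod p" "x \<in> A'" "y \<in> B'" by (auto simp: sumset_mod_def)
      show "s \<in> sumset_mod p A B"
      proof (cases "x \<in> A")
        case True
        then show ?thesis using s by (auto simp: sumset_mod_def B'_def)
      next
        case False
        then obtain b where b: "b \<in> B" "x = (b + e) mod p" using s MB by (auto simp: A'_def)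
        \<comment> \<open>Swap the shift: \<open>(b + e) + y = (y + e) + b\<close>, and
          \<open>y + e\<close> lies in \<open>A\<close> modulo \<open>p\<close> because
          \<open>y\<close> was not moved.\<close>
        have "(y + e) mod p \<in> A" using s by (auto simp: B'_def M_def)
        moreover have "s = ((y + e) mod p + b) mod p"
        proof -
          have "s = (b + e + y) mod p" by (simp only: s b mod_add_left_eq)
          also have "b + e + y = (y + e) + b" by simp
          finally show ?thesis by (simp only: mod_add_left_eq)
        qed
        ultimately show ?thesis using b by (force simp: sumset_mod_def)
      qed
    qed
    finally show ?thesis by (simp add: cards)
  qed
qed

text \<open>Pigeonhole: \<open>A + B\<close> and the reflected set \<open>x - C\<close> together
  have more than \<open>p\<close> elements, so they meet.\<close>

lemma three_sets_cover_mod_prime: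
  fixes p :: int
  assumes p: "prime p" and sub: "A \<subseteq> {0..<p}" "B \<subseteq> {0..<p}" "C \<subseteq> {0..<p}"
    and ne: "A \<noteq> {}" "B \<noteq> {}" "C \<noteq> {}" and card: "nat p + 2 \<le> card A + card B + card C"
  obtains a b c where "a \<in> A" "b \<in> B" "c \<in> C" "[a + b + c = x] (mod p)"
proof -
  have p0: "p > 0" using p by (simp add: prime_gt_0_int)
  let ?S = "sumset_mod p A B" and ?T = "(\<lambda>c. (x - c) mod p) ` C"
  have "inj_on (\<lambda>c. (x - c) mod p) C"
  proof (rule inj_onI)
    fix c d assume *: "c \<in> C" "d \<in> C" "(x - c) mod p = (x - d) mod p"
    have "(x - (x - c)) mod p = (x - (x - d)) mod p" by (rule mod_diff_cong[OF refl *(3)])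
    moreover have "0 \<le> c" "c < p" "0 \<le> d" "d < p" using * sub(3) by auto
    ultimately show "c = d" by simp
  qed
  then have T: "card ?T = card C" by (rule card_image)
  have "?S \<inter> ?T \<noteq> {}"
  proof
    assume "?S \<inter> ?T = {}"
    moreover have "finite ?S" "finite ?T"
      using sub by (auto simp: sumset_mod_def intro: finite_subset)
    ultimately have "card ?S + card ?T = card (?S \<union> ?T)" by (simp add: card_Un_disjoint)
    also have "\<dots> \<le> card {0..<p}" using p0 by (intro card_mono) (auto simp: sumset_mod_def)
    finally have "card ?S + card C \<le> nat p" by (simp add: T)
    moreover have "card C > 0" using ne sub by (auto simp: card_gt_0_iff intro: finite_subset)
    ultimately show False using Cauchy_Davenport[OF p sub(1,2) ne(1,2)] card by auto
  qed
  then obtain a b c where *: "a \<in> A" "b \<in> B" "c \<in> C" "(a + b) mod p = (x - c) mod p"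
    by (auto simp: sumset_mod_def)
  then have "[a + b + c = x - c + c] (mod p)" by (intro cong_add) (auto simp: cong_def)
  then show ?thesis using that * by simp
qed

subsection \<open>Transfer from averages to values\<close>

lemma nonincreasing_enumeration:
  fixes f :: "'a \<Rightarrow> real"
  assumes "finite S"
  obtains e where "bij_betw e {..<card S} S" "nonincreasing (card S) (\<lambda>i. f (e i))"
proof -
  obtain ys where ys: "set ys = S" "distinct ys" using assms finite_distinct_list by blast
  define xs where "xs = sort_key (\<lambda>x. - f x) ys"
  have xs: "set xs = S" "distinct xs" using ys by (auto simp: xs_def)
  then have len: "length xs = card S" using distinct_card by metis
  have "sorted (map (\<lambda>x. - f x) xs)" by (simp add: xs_def)
  then have "nonincreasing (card S) (\<lambda>i. f (xs ! i))"
    using sorted_nth_mono[of "map (\<lambda>x. - f x) xs"] by (auto simp: nonincreasing_def len)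
  moreover have "bij_betw (nth xs) {..<card S} S"
    using bij_betw_nth[OF xs(2)] xs(1) len by metis
  ultimately show ?thesis using that by blast
qed

lemma mean_bij_betw: "bij_betw e T S \<Longrightarrow> mean S f = mean T (\<lambda>i. f (e i))"
  unfolding mean_def by (metis bij_betw_same_card sum.reindex_bij_betw)

definition residue_units :: "int \<Rightarrow> int set" where
  "residue_units m = {x. 0 \<le> x \<and> x < m \<and> coprime x m}"

text \<open>Three functions are needed even for a single set \<open>A\<close>: once different
  residues are fixed modulo one factor, the restrictions to the three fibres differ.\<close>

definition transfers :: "real set \<Rightarrow> int \<Rightarrow> bool" where
  "transfers V m \<longleftrightarrow> (\<forall>f g h x.
     f ` residue_units m \<subseteq> V \<and> g ` residue_units m \<subseteq> V \<and> h ` residue_units m \<subseteq> V \<and>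
     0 < excess (mean (residue_units m) f) (mean (residue_units m) g) (mean (residue_units m) h) \<longrightarrow>
     (\<exists>a\<in>residue_units m. \<exists>b\<in>residue_units m. \<exists>c\<in>residue_units m.
        [a + b + c = x] (mod m) \<and> 0 < excess (f a) (g b) (h c)))"

lemma transfersD:
  assumes "transfers V m" "f ` residue_units m \<subseteq> V" "g ` residue_units m \<subseteq> V" "h ` residue_units m \<subseteq> V"
     "0 < excess (mean (residue_units m) f) (mean (residue_units m) g) (mean (residue_units m) h)"
  obtains a b c where "a \<in> residue_units m" "b \<in> residue_units m" "c \<in> residue_units m"
    "[a + b + c = x] (mod m)" "0 < excess (f a) (g b) (h c)"
  using assms unfolding transfers_def by metis

lemma transfers_subset: "transfers W m \<Longrightarrow> V \<subseteq> W \<Longrightarrow> transfers V m"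
  unfolding transfers_def by (meson order_trans)

lemma finite_residue_units [simp]: "finite (residue_units m)"
  by (rule finite_subset[of _ "{0..<m}"]) (auto simp: residue_units_def)

lemma residue_units_1 [simp]: "residue_units 1 = {0}"
  by (auto simp: residue_units_def)

lemma residue_units_prime:
  assumes "prime p"
  shows "residue_units p = {1..<p}"
proof (intro equalityI subsetI)
  fix x assume "x \<in> residue_units p"
  moreover have "x \<noteq> 0" if "coprime x p" using that assms by auto
  ultimately show "x \<in> {1..<p}" by (auto simp: residue_units_def)
next
  fix x assume x: "x \<in> {1..<p}"
  then have "\<not> p dvd x" by (simp add: zdvd_not_zless)
  then show "x \<in> residue_units p"
    using x assms by (auto simp: residue_units_def coprime_commute prime_imp_coprime)
qed

lemma transfers_1: "transfers V 1"
  by (simp add: transfers_def mean_def)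

lemma transfers_prime:
  assumes p: "prime (int p)" and V: "V \<subseteq> {0..1}" and closed: "mean_closed V (p - 1)"
  shows "transfers V (int p)"
  unfolding transfers_def
proof (intro allI impI, elim conjE)
  fix f g h :: "int \<Rightarrow> real" and x :: int
  let ?U = "residue_units (int p)"
  assume img: "f ` ?U \<subseteq> V" "g ` ?U \<subseteq> V" "h ` ?U \<subseteq> V"
    and pos: "0 < excess (mean ?U f) (mean ?U g) (mean ?U h)"
  have card: "card ?U = p - 1" by (simp add: residue_units_prime[OF p])
  have sub: "?U \<subseteq> {0..<int p}" by (auto simp: residue_units_def)
  obtain s where s: "bij_betw s {..<p - 1} ?U" "nonincreasing (p - 1) (\<lambda>i. f (s i))"
    using nonincreasing_enumeration[of ?U f] by (auto simp: card)
  obtain t where t: "bij_betw t {..<p - 1} ?U" "nonincreasing (p - 1) (\<lambda>i. g (t i))"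
    using nonincreasing_enumeration[of ?U g] by (auto simp: card)
  obtain u where u: "bij_betw u {..<p - 1} ?U" "nonincreasing (p - 1) (\<lambda>i. h (u i))"
    using nonincreasing_enumeration[of ?U h] by (auto simp: card)
  have "(\<lambda>i. f (s i)) ` {..<p - 1} \<subseteq> V" "(\<lambda>i. g (t i)) ` {..<p - 1} \<subseteq> V" "(\<lambda>i. h (u i)) ` {..<p - 1} \<subseteq> V"
    using img bij_betwE[OF s(1)] bij_betwE[OF t(1)] bij_betwE[OF u(1)] by blast+
  then have "\<not> (\<forall>i<p - 1. \<forall>j<p - 1. \<forall>k<p - 1. p - 1 \<le> i + j + k \<longrightarrow> excess (f (s i)) (g (t j)) (h (u k)) \<le> 0)"
    using closed[unfolded mean_closed_def, rule_format, of "\<lambda>i. f (s i)" "\<lambda>i. g (t i)" "\<lambda>i. h (u i)"]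
      pos[unfolded mean_bij_betw[OF s(1), of f] mean_bij_betw[OF t(1), of g] mean_bij_betw[OF u(1), of h]]
      s(2) t(2) u(2) by (meson not_le)
  then obtain i j k where ijk: "i < p - 1" "j < p - 1" "k < p - 1" "p - 1 \<le> i + j + k"
      and good: "0 < excess (f (s i)) (g (t j)) (h (u k))"
    unfolding not_all not_imp not_le by blast
  have prefix: "card (e ` {..l}) = Suc l" "e ` {..l} \<subseteq> ?U"
    if "bij_betw e {..<p - 1} ?U" "l < p - 1" for e and l :: nat
  proof -
    have l: "{..l} \<subseteq> {..<p - 1}" using that(2) by auto
    show "card (e ` {..l}) = Suc l"
      using card_image[OF inj_on_subset[OF bij_betw_imp_inj_on[OF that(1)] l]] by simp
    show "e ` {..l} \<subseteq> ?U" using bij_betwE[OF that(1)] l by blast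
  qed
  obtain a b c where abc: "a \<in> s ` {..i}" "b \<in> t ` {..j}" "c \<in> u ` {..k}" "[a + b + c = x] (mod int p)"
  proof (rule three_sets_cover_mod_prime[OF p])
    show "s ` {..i} \<subseteq> {0..<int p}" "t ` {..j} \<subseteq> {0..<int p}" "u ` {..k} \<subseteq> {0..<int p}"
      using prefix(2)[OF s(1) ijk(1)] prefix(2)[OF t(1) ijk(2)] prefix(2)[OF u(1) ijk(3)] sub by blast+
    \<comment> \<open>Indices start at 0, so the prefixes have \<open>i + 1\<close>,
      \<open>j + 1\<close> and \<open>k + 1\<close> elements, and \<open>p - 1 <= i + j + k\<close>
      is exactly the size required.\<close>
    show "nat (int p) + 2 \<le> card (s ` {..i}) + card (t ` {..j}) + card (u ` {..k})"
      using prefix(1)[OF s(1) ijk(1)] prefix(1)[OF t(1) ijk(2)] prefix(1)[OF u(1) ijk(3)] ijk by simp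
  qed auto
  have U: "a \<in> ?U" "b \<in> ?U" "c \<in> ?U"
    using abc prefix(2)[OF s(1) ijk(1)] prefix(2)[OF t(1) ijk(2)] prefix(2)[OF u(1) ijk(3)] by blast+
  have U': "s i \<in> ?U" "t j \<in> ?U" "u k \<in> ?U"
    using s(1) t(1) u(1) ijk by (auto simp: bij_betw_def)
  \<comment> \<open>Members of a prefix have at least the value at its last index, and increases
    preserve positive excess.\<close>
  have "f (s i) \<le> f a" "g (t j) \<le> g b" "h (u k) \<le> h c"
    using abc s(2) t(2) u(2) ijk by (auto simp: nonincreasing_def)
  then have "0 < excess (f a) (g b) (h c)"
    using U U' img V by (intro excess_pos_mono[OF _ _ _ good]) (auto simp: image_subset_iff subset_iff)
  then show "\<exists>a\<in>?U. \<exists>b\<in>?U. \<exists>c\<in>?U. [a + b + c = x] (mod int p) \<and> 0 < excess (f a) (g b) (h c)"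
    using U abc(4) by blast
qed

section \<open>Combining coprime moduli\<close>

lemma bij_betw_residue_units_mult:
  assumes "m > 0" "n > 0" "coprime m n"
  shows "bij_betw (\<lambda>z. (z mod m, z mod n)) (residue_units (m * n)) (residue_units m \<times> residue_units n)"
proof (rule bij_betwI')
  fix z w assume zw: "z \<in> residue_units (m * n)" "w \<in> residue_units (m * n)"
  show "((z mod m, z mod n) = (w mod m, w mod n)) = (z = w)"
  proof
    assume "(z mod m, z mod n) = (w mod m, w mod n)"
    then have "[z = w] (mod m * n)" using assms by (intro coprime_cong_mult) (auto simp: cong_def)
    then show "z = w" using zw by (intro cong_less_imp_eq_int[of z "m * n"]) (auto simp: residue_units_def)
  qed simp
next
  fix z assume "z \<in> residue_units (m * n)"
  then show "(z mod m, z mod n) \<in> residue_units m \<times> residue_units n"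
    using assms by (auto simp: residue_units_def)
next
  fix yr assume "yr \<in> residue_units m \<times> residue_units n"
  then obtain y r where yr: "yr = (y, r)" "y \<in> residue_units m" "r \<in> residue_units n" by blast
  obtain z where z: "[z = y] (mod m)" "[z = r] (mod n)"
    using binary_chinese_remainder_int[OF assms(3)] by blast
  have *: "z mod (m * n) mod m = y" "z mod (m * n) mod n = r"
    using z yr by (auto simp: residue_units_def cong_def mod_mod_cancel)
  then have "coprime (z mod (m * n)) m" "coprime (z mod (m * n)) n"
    using yr assms coprime_mod_left_iff[of m "z mod (m * n)"] coprime_mod_left_iff[of n "z mod (m * n)"]
    unfolding * by (auto simp: residue_units_def)
  then have "z mod (m * n) \<in> residue_units (m * n)"
    using assms by (simp add: residue_units_def)
  then show "\<exists>z\<in>residue_units (m * n). yr = (z mod m, z mod n)" using yr * by metis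
qed

text \<open>Transfer modulo \<open>m\<close> is applied to the averages over the fibres, whose
  values lie in \<open>W\<close>, and fixes three residues modulo \<open>m\<close>. Transfer modulo
  \<open>n\<close> then acts on the three chosen fibres, and the Chinese remainder theorem glues the
  residues.\<close>

lemma transfers_mult:
  assumes mn: "m > 0" "n > 0" "coprime m n" and m: "transfers W m" and n: "transfers V n"
    and means: "\<And>f. f ` residue_units n \<subseteq> V \<Longrightarrow> mean (residue_units n) f \<in> W"
  shows "transfers V (m * n)"
  unfolding transfers_def
proof (intro allI impI, elim conjE)
  fix f g h :: "int \<Rightarrow> real" and x :: int
  let ?U = "residue_units (m * n)"
  assume img: "f ` ?U \<subseteq> V" "g ` ?U \<subseteq> V" "h ` ?U \<subseteq> V"
    and pos: "0 < excess (mean ?U f) (mean ?U g) (mean ?U h)"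
  define \<chi> where "\<chi> = the_inv_into ?U (\<lambda>z. (z mod m, z mod n))"
  note bij = bij_betw_residue_units_mult[OF mn]
  have \<chi>: "bij_betw \<chi> (residue_units m \<times> residue_units n) ?U"
    unfolding \<chi>_def by (rule bij_betw_the_inv_into[OF bij])
  have \<chi>_mod: "\<chi> (y, r) mod m = y" "\<chi> (y, r) mod n = r" "\<chi> (y, r) \<in> ?U"
    if "y \<in> residue_units m" "r \<in> residue_units n" for y r
    using that f_the_inv_into_f_bij_betw[OF bij, of "(y, r)"] \<chi> unfolding \<chi>_def
    by (auto simp: bij_betw_def)
  define F where "F f y = mean (residue_units n) (\<lambda>r. f (\<chi> (y, r)))" for f :: "int \<Rightarrow> real" and y
  have mean_F: "mean ?U f = mean (residue_units m) (F f)" for f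
    unfolding mean_bij_betw[OF \<chi>] F_def
    by (simp add: mean_def card_cartesian_product sum.cartesian_product split_def mult.commute
        flip: sum_divide_distrib)
  have img_F: "F f ` residue_units m \<subseteq> W" if "f ` ?U \<subseteq> V" for f
    unfolding F_def using that \<chi>_mod(3) by (auto intro!: means)
  obtain y1 y2 y3 where y: "y1 \<in> residue_units m" "y2 \<in> residue_units m" "y3 \<in> residue_units m"
    "[y1 + y2 + y3 = x] (mod m)" "0 < excess (F f y1) (F g y2) (F h y3)"
    using transfersD[OF m img_F[OF img(1)] img_F[OF img(2)] img_F[OF img(3)]] pos unfolding mean_F by metis
  obtain r1 r2 r3 where r: "r1 \<in> residue_units n" "r2 \<in> residue_units n" "r3 \<in> residue_units n"
    "[r1 + r2 + r3 = x] (mod n)" "0 < excess (f (\<chi> (y1, r1))) (g (\<chi> (y2, r2))) (h (\<chi> (y3, r3)))"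
  proof (rule transfersD[OF n, of "\<lambda>r. f (\<chi> (y1, r))" "\<lambda>r. g (\<chi> (y2, r))" "\<lambda>r. h (\<chi> (y3, r))" x])
    show "(\<lambda>r. f (\<chi> (y1, r))) ` residue_units n \<subseteq> V" "(\<lambda>r. g (\<chi> (y2, r))) ` residue_units n \<subseteq> V"
      "(\<lambda>r. h (\<chi> (y3, r))) ` residue_units n \<subseteq> V"
      using img \<chi>_mod(3) y by auto
  qed (use y(5) in \<open>auto simp: F_def\<close>)
  let ?s = "\<chi> (y1, r1) + \<chi> (y2, r2) + \<chi> (y3, r3)"
  have \<chi>_cong: "[\<chi> (y, r) = y] (mod m)" "[\<chi> (y, r) = r] (mod n)"
    if "y \<in> residue_units m" "r \<in> residue_units n" for y r
    using \<chi>_mod[OF that] that by (auto simp: cong_def residue_units_def)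
  have "[?s = y1 + y2 + y3] (mod m)" "[?s = r1 + r2 + r3] (mod n)"
    by (intro cong_add \<chi>_cong y r)+
  then have "[?s = x] (mod m)" "[?s = x] (mod n)" using y(4) r(4) cong_trans by blast+
  then have "[?s = x] (mod m * n)" using mn(3) by (rule coprime_cong_mult)
  then show "\<exists>a\<in>?U. \<exists>b\<in>?U. \<exists>c\<in>?U. [a + b + c = x] (mod m * n) \<and> 0 < excess (f a) (g b) (h c)"
    using r \<chi>_mod(3) y by metis
qed

lemma mean_residue_units_in:
  assumes "f ` residue_units m \<subseteq> {0..1}" "residue_units m \<noteq> {}"
  shows "mean (residue_units m) f \<in> {0..1}"
  using mean_bounds[of "residue_units m" 0 f 1] assms by (auto simp: image_subset_iff)

lemma one_in_residue_units: "m > 1 \<Longrightarrow> 1 \<in> residue_units m"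
  by (simp add: residue_units_def)

section \<open>Induction over the prime factors\<close>

lemma squarefree_prime_mult_coprime:
  fixes p k :: nat
  assumes "prime p" "squarefree (p * k)"
  shows "coprime p k"
proof (rule prime_imp_coprime[OF assms(1)])
  show "\<not> p dvd k"
  proof
    assume "p dvd k"
    then have "p\<^sup>2 dvd p * k" by (simp add: power2_eq_square)
    then have "p dvd 1" by (rule squarefreeD[OF assms(2)])
    then show False using assms(1) by simp
  qed
qed

text \<open>Coprimality to 30 leaves only primes from 7 on, for which \<open>p - 1 = 2 * h\<close>
  with \<open>h >= 3\<close>; means never leave the unit interval, so one value set serves the whole
  induction.\<close>

lemma transfers_unit_interval:
  fixes m :: nat
  assumes "m > 0" "squarefree m" "coprime m 30"
  shows "transfers {0..1} (int m)"
  using assms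
proof (induction m rule: less_induct)
  case (less m)
  show ?case
  proof (cases "m = 1")
    case True then show ?thesis using transfers_1 by simp
  next
    case False
    then obtain p where p: "prime p" "p dvd m" using prime_factor_nat by blast
    obtain k where k: "m = p * k" using p by blast
    have "coprime p 30" using less.prems(3) unfolding k by simp
    have pk: "coprime p k" "squarefree k"
      using less.prems(2) squarefree_prime_mult_coprime[OF p(1)] squarefree_multD(2)
      unfolding k by blast+
    have "coprime k 30" using less.prems(3) unfolding k by simp
    have "k > 0" using less.prems(1) k by (cases k) auto
    then have "k < m" using prime_gt_1_nat[OF p(1)] k by simp
    have nd: "\<not> r dvd p" if "r dvd 30" "r \<noteq> 1" for r
      using \<open>coprime p 30\<close> that coprime_common_divisor_nat by blast
    have "odd p" "p \<noteq> 3" "p \<noteq> 5" using nd[of 2] nd[of 3] nd[of 5] by auto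
    moreover have "p > 1" using p(1) by (rule prime_gt_1_nat)
    ultimately have "p - 1 = 2 * ((p - 1) div 2)" "(p - 1) div 2 \<ge> 3" by presburger+
    then have "mean_closed {0..1} (p - 1)" using mean_closed_unit_interval by metis
    then have "transfers {0..1} (int p)" using p(1) by (intro transfers_prime) auto
    moreover have "transfers {0..1} (int k)" using less.IH pk \<open>coprime k 30\<close> \<open>k > 0\<close> \<open>k < m\<close> by blast
    moreover have "mean (residue_units (int p)) f \<in> {0..1}" if "f ` residue_units (int p) \<subseteq> {0..1}" for f
      using that one_in_residue_units[of "int p"] prime_gt_1_nat[OF p(1)]
      by (intro mean_residue_units_in) auto
    ultimately have "transfers {0..1} (int k * int p)"
      using pk(1) \<open>k > 0\<close> p(1) by (intro transfers_mult) (auto simp: coprime_commute prime_gt_0_nat)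
    then show ?thesis by (simp add: k mult.commute)
  qed
qed

text \<open>Removes \<open>p\<close> whether or not it divides \<open>m\<close>; if it does not,
  \<open>V \<subseteq> W\<close> suffices. The primes excluded so far are collected in
  \<open>d\<close>.\<close>

lemma transfers_prime_factor:
  fixes m p :: nat
  assumes m: "m > 0" "squarefree m" "coprime m d" and p: "prime p"
    and V: "V \<subseteq> W" "V \<subseteq> {0..1}" "mean_closed V (p - 1)"
    and means: "\<And>f. f ` residue_units (int p) \<subseteq> V \<Longrightarrow> mean (residue_units (int p)) f \<in> W"
    and IH: "\<And>k. k > 0 \<Longrightarrow> squarefree k \<Longrightarrow> coprime k (p * d) \<Longrightarrow> transfers W (int k)"
  shows "transfers V (int m)"
proof (cases "p dvd m")
  case True
  then obtain k where k: "m = p * k" by blast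
  have pk: "coprime p k" "squarefree k"
    using m(2) squarefree_prime_mult_coprime[OF p] squarefree_multD(2) unfolding k by blast+
  have "coprime k d" using m(3) unfolding k by simp
  then have "coprime k (p * d)" using pk(1) by (simp add: coprime_commute)
  have "k > 0" using m(1) k by (cases k) auto
  then have "transfers W (int k)" using IH pk(2) \<open>coprime k (p * d)\<close> by blast
  moreover have "transfers V (int p)" using p V by (intro transfers_prime) auto
  ultimately have "transfers V (int k * int p)"
    using pk(1) \<open>k > 0\<close> means p by (intro transfers_mult) (auto simp: coprime_commute prime_gt_0_nat)
  then show ?thesis by (simp add: k mult.commute)
next
  case False
  then have "coprime m (p * d)" using m(3) prime_imp_coprime[OF p] by (simp add: coprime_commute)
  then show ?thesis using IH m V(1) transfers_subset by blast
qed

text \<open>The value sets grow as primes are removed: averaging indicators over the two units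
  modulo 3 gives \<open>{0, 1/2, 1}\<close>, and averaging those modulo 5 stays in the unit
  interval.\<close>

lemma transfers_indicators:
  fixes m :: nat
  assumes m: "m > 0" "squarefree m" "odd m"
  shows "transfers {0, 1} (int m)"
proof (rule transfers_prime_factor[where p = 3 and d = 2 and W = "{0, 1/2, 1}"])
  show "mean_closed {0, 1} (3 - 1)" using mean_closed_2 by simp
  have U: "residue_units (int 3) = {1, 2}"
    by (subst residue_units_prime) auto
  show "mean (residue_units (int 3)) f \<in> {0, 1/2, 1}" if "f ` residue_units (int 3) \<subseteq> {0, 1}" for f
    using that unfolding U by (auto simp: mean_def)
next
  fix k :: nat assume k: "k > 0" "squarefree k" "coprime k (3 * 2)"
  show "transfers {0, 1/2, 1} (int k)"
  proof (rule transfers_prime_factor[where p = 5 and d = 6 and W = "{0..1}"])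
    show "mean_closed {0, 1/2, 1} (5 - 1)" using mean_closed_4 by simp
    show "mean (residue_units (int 5)) f \<in> {0..1}" if "f ` residue_units (int 5) \<subseteq> {0, 1/2, 1}" for f
      using that one_in_residue_units[of "int 5"]
      by (intro mean_residue_units_in) auto
    show "transfers {0..1} (int k)" if "k > 0" "squarefree k" "coprime k (5 * 6)" for k :: nat
      using that by (intro transfers_unit_interval) auto
  qed (use k in auto)
qed (use m in auto)

lemma card_residue_units: "m > 0 \<Longrightarrow> card (residue_units (int m)) = totient m"
\<comment> \<open>For \<open>m = 1\<close> the unit is represented by 0 in
  \<open>residue_units\<close> but by 1 in \<open>totatives\<close>.\<close>
proof (cases "m = 1")
  case False
  assume "m > 0"
  with False have m: "m > 1" by simp
  have "residue_units (int m) = int ` totatives m"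
  proof (intro equalityI subsetI)
    fix x assume x: "x \<in> residue_units (int m)"
    then obtain n where n: "x = int n" by (auto simp: residue_units_def elim: nonneg_int_cases)
    have "n \<in> totatives m"
      using x m unfolding n by (cases "n = 0") (auto simp: residue_units_def in_totatives_iff)
    then show "x \<in> int ` totatives m" by (simp add: n)
  next
    fix x assume "x \<in> int ` totatives m"
    then show "x \<in> residue_units (int m)"
      using m totatives_less by (auto simp: residue_units_def in_totatives_iff)
  qed
  then show ?thesis by (simp add: totient_def card_image)
qed simp

lemma three_dense_unit_summands:
  fixes m :: nat
  assumes m: "m > 0" "odd m" "squarefree m"
    and S: "S \<subseteq> residue_units (int m)" "real (card S) > 5 / 8 * real (totient m)"
  obtains a b c where "a \<in> S" "b \<in> S" "c \<in> S" "[a + b + c = x] (mod int m)"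
proof -
  let ?U = "residue_units (int m)" and ?f = "\<lambda>x. if x \<in> S then 1 else 0 :: real"
  have "mean ?U ?f = card S / totient m"
    using S(1) by (simp add: mean_def card_residue_units[OF m(1)] Int_absorb1 flip: sum.inter_restrict)
  moreover have "card S / totient m > 5/8" using S(2) m(1) by (simp add: field_simps)
  ultimately have t: "mean ?U ?f > 5/8" by simp
  \<comment> \<open>The excess at three equal densities \<open>t\<close> is
    \<open>t * (24 * t - 15)\<close>, which is where the threshold \<open>5/8\<close>
    enters.\<close>
  then have "mean ?U ?f * (24 * mean ?U ?f - 15) > 0" by (intro mult_pos_pos) auto
  then have pos: "excess (mean ?U ?f) (mean ?U ?f) (mean ?U ?f) > 0" by (simp add: excess_def algebra_simps)
  have img: "?f ` ?U \<subseteq> {0, 1}" by auto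
  obtain a b c where abc: "[a + b + c = x] (mod int m)" "excess (?f a) (?f b) (?f c) > 0"
    using transfersD[OF transfers_indicators[OF m(1,3,2)] img img img pos] by metis
  then have "a \<in> S \<and> b \<in> S \<and> c \<in> S" by (auto simp: excess_def split: if_splits)
  then show ?thesis using that abc by blast
qed

subsection \<open>Cosets\<close>

lemma ZMod_ideal: "ideal (Idl\<^bsub>\<Z>\<^esub> {m}) \<Z>"
  by (rule int.genideal_ideal) simp

lemma carrier_ZFact: "carrier (ZFact m) = range (ZMod m)"
  by (auto simp: ZFact_defs A_RCOSETS_def' ZMod_def)

lemma ZFact_add: "ZMod m a \<oplus>\<^bsub>ZFact m\<^esub> ZMod m b = ZMod m (a + b)"
proof -
  interpret ideal "Idl\<^bsub>\<Z>\<^esub> {m}" \<Z> by (rule ZMod_ideal)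
  show ?thesis using a_rcos_sum[of a b] by (simp add: ZFact_defs ZMod_def)
qed

lemma ZFact_mult: "ZMod m a \<otimes>\<^bsub>ZFact m\<^esub> ZMod m b = ZMod m (a * b)"
proof -
  interpret ideal "Idl\<^bsub>\<Z>\<^esub> {m}" \<Z> by (rule ZMod_ideal)
  show ?thesis using rcoset_mult_add[of a b] by (simp add: ZFact_defs ZMod_def)
qed

lemma Units_ZFact_coprime:
  assumes "ZMod m a \<in> Units (ZFact m)"
  shows "coprime a m"
proof -
  have one: "\<one>\<^bsub>ZFact m\<^esub> = ZMod m 1" by (simp add: ZFact_defs ZMod_def)
  obtain b where "ZMod m a \<otimes>\<^bsub>ZFact m\<^esub> ZMod m b = ZMod m 1"
    using assms unfolding Units_def carrier_ZFact one by blast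
  then have "[a * b = 1] (mod m)" by (simp add: ZFact_mult ZMod_eq_mod cong_def)
  then show ?thesis using coprime_iff_invertible_int by blast
qed

theorem corollary1p5:
  fixes m :: nat and A :: "int set set"
  assumes "m > 0" and "odd m" and "squarefree m"
    and "A \<subseteq> Units (ZFact (int m))"
    and "real (card A) > 5 / 8 * real (totient m)"
  shows "A <+>\<^bsub>ZFact (int m)\<^esub> A <+>\<^bsub>ZFact (int m)\<^esub> A = carrier (ZFact (int m))"
proof
  have A: "A \<subseteq> range (ZMod (int m))"
    using assms(4) by (auto simp: Units_def carrier_ZFact)
  interpret R: cring "ZFact (int m)" by (rule ZFact_is_cring)
  show "A <+>\<^bsub>ZFact (int m)\<^esub> A <+>\<^bsub>ZFact (int m)\<^esub> A \<subseteq> carrier (ZFact (int m))"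
    using A by (intro R.set_add_closed) (auto simp: carrier_ZFact)
  \<comment> \<open>Least nonnegative representatives turn the set of cosets into a set of integers
    of the same size.\<close>
  define S where "S = {a \<in> {0..<int m}. ZMod (int m) a \<in> A}"
  have "A = ZMod (int m) ` S"
  proof (intro equalityI subsetI)
    fix X assume "X \<in> A"
    then obtain a where "X = ZMod (int m) (a mod int m)" using A ZMod_mod by blast
    then show "X \<in> ZMod (int m) ` S"
      using \<open>X \<in> A\<close> assms(1) by (auto simp: S_def)
  qed (auto simp: S_def)
  moreover have "inj_on (ZMod (int m)) S"
    by (auto simp: inj_on_def S_def ZMod_eq_mod)
  ultimately have card: "card A = card S" by (simp add: card_image)
  have S: "S \<subseteq> residue_units (int m)"
    using assms(4) Units_ZFact_coprime by (auto simp: S_def residue_units_def)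
  show "carrier (ZFact (int m)) \<subseteq> A <+>\<^bsub>ZFact (int m)\<^esub> A <+>\<^bsub>ZFact (int m)\<^esub> A"
  proof
    fix X assume "X \<in> carrier (ZFact (int m))"
    then obtain x where x: "X = ZMod (int m) x" by (auto simp: carrier_ZFact)
    obtain a b c where abc: "a \<in> S" "b \<in> S" "c \<in> S" "[a + b + c = x] (mod int m)"
      using three_dense_unit_summands[OF assms(1-3) S] assms(5) card by metis
    then have "X = ZMod (int m) a \<oplus>\<^bsub>ZFact (int m)\<^esub> ZMod (int m) b \<oplus>\<^bsub>ZFact (int m)\<^esub> ZMod (int m) c"
      by (simp add: x ZFact_add ZMod_eq_mod cong_def)
    then show "X \<in> A <+>\<^bsub>ZFact (int m)\<^esub> A <+>\<^bsub>ZFact (int m)\<^esub> A"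
      using abc by (auto simp: set_add_def' S_def)
  qed
qed

end
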